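(* Let $m,\ell\in\mathbb{N}$. There is a $3$-coloring of $\mathbb{N}$ such that, for every infinite $B\subseteq\mathbb{N}$ and every $t\in\mathbb{Z}$, the set $$\{(m+\ell)x:x\in B\}\cup\{mx+\ell y+t:x,y\in B,\ x<y\},$$ whenever it is contained in $\mathbb{N}$, is not monochromatic.
   Context: $\mathbb{N}=\{1,2,3,\ldots\}$. An $r$-coloring of a set $S$ is a map from $S$ to a set with $r$ elements; a subset of $S$ is monochromatic if the coloring is constant on it. The coloring may depend on $m,\ell$ but not on $B$ or $t$. *)

theory Defs
  imports Complex_Main
begin

(* The positive integers, taken inside int because the shift t may be negative. *)
definition pos_ints :: "int set" where
  "pos_ints = {n. 1 \<le> n}"

(* {..<r} serves as the set of r colors; values of c outside S are irrelevant. *)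
definition coloring :: "nat \<Rightarrow> 'a set \<Rightarrow> ('a \<Rightarrow> nat) \<Rightarrow> bool" where
  "coloring r S c \<longleftrightarrow> (\<forall>s\<in>S. c s \<in> {..<r})"

definition monochromatic :: "('a \<Rightarrow> 'b) \<Rightarrow> 'a set \<Rightarrow> bool" where
  "monochromatic c A \<longleftrightarrow> (\<forall>a\<in>A. \<forall>b\<in>A. c a = c b)"

definition pattern :: "int \<Rightarrow> int \<Rightarrow> int \<Rightarrow> int set \<Rightarrow> int set" where
  "pattern m l t B = {(m + l) * x | x. x \<in> B} \<union> {m * x + l * y + t | x y. x \<in> B \<and> y \<in> B \<and> x < y}"

end

theory Submission
  imports Defs "HOL-Real_Asymp.Real_Asymp"
begin

text \<open>
  Fix \<open>x \<in> B\<close> and let \<open>y \<in> B\<close> tend to infinity. The ratio of the two pattern elements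
  \<open>(m + l) y\<close> and \<open>m x + l y + t\<close> then tends to \<open>\<rho> = (m + l) / l > 1\<close>. Hence it suffices to color
  \<open>n\<close> by the residue modulo 3 of \<open>\<lfloor>3/2 \<cdot> log \<rho> n\<rfloor>\<close>: for large \<open>y\<close> the two
  values of \<open>3/2 \<cdot> log \<rho>\<close> differ by a number close to \<open>3/2\<close>, so strictly between 1 and 2, and
  their floors differ by 1 or 2. No other elements of the pattern are needed.
\<close>

text \<open>
  For \<open>\<rho> > 1\<close>, the multiplicative blocks from \<open>\<rho> powr (2 * k / 3)\<close> (included) to
  \<open>\<rho> powr (2 * (k + 1) / 3)\<close> (excluded) receive the three colors cyclically as the integer
  \<open>k\<close> increases.
\<close>

definition log_coloring :: "real \<Rightarrow> int \<Rightarrow> nat" where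
  "log_coloring \<rho> n = nat (\<lfloor>3/2 * log \<rho> (of_int n)\<rfloor> mod 3)"

lemma floor_mod_3_neq:
  fixes u v :: real
  assumes "1 < v - u" and "v - u < 2"
  shows "\<lfloor>v\<rfloor> mod 3 \<noteq> \<lfloor>u\<rfloor> mod 3"
proof -
  have "\<lfloor>v\<rfloor> - \<lfloor>u\<rfloor> = 1 \<or> \<lfloor>v\<rfloor> - \<lfloor>u\<rfloor> = 2"
    using assms by linarith
  then show ?thesis by presburger
qed

lemma log_coloring_neq:
  assumes "2/3 < log \<rho> (of_int b) - log \<rho> (of_int a)"
    and "log \<rho> (of_int b) - log \<rho> (of_int a) < 4/3"
  shows "log_coloring \<rho> b \<noteq> log_coloring \<rho> a"
proof -
  have "\<lfloor>3/2 * log \<rho> (of_int b)\<rfloor> mod 3 \<noteq> \<lfloor>3/2 * log \<rho> (of_int a)\<rfloor> mod 3"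
    by (rule floor_mod_3_neq) (use assms in linarith)+
  then show ?thesis
    by (simp add: log_coloring_def nat_eq_iff)
qed

lemma log_ratio_tendsto_1:
  fixes m l k :: real
  assumes "m > 0" and "l > 0"
  shows "((\<lambda>y. log ((m + l) / l) ((m + l) * y) - log ((m + l) / l) (l * y + k)) \<longlongrightarrow> 1) at_top"
proof -
  let ?\<rho> = "(m + l) / l"
  have rho: "?\<rho> > 1" using assms by simp
  have "((\<lambda>y. (m + l) * y / (l * y + k)) \<longlongrightarrow> ?\<rho>) at_top"
    using assms by (real_asymp simp: divide_inverse)
  then have "((\<lambda>y. log ?\<rho> ((m + l) * y / (l * y + k))) \<longlongrightarrow> log ?\<rho> ?\<rho>) at_top"
    using rho by (intro tendsto_log tendsto_const) auto
  moreover have "\<forall>\<^sub>F y in at_top. l * y + k > 0"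
    using assms by real_asymp
  then have "\<forall>\<^sub>F y in at_top. log ?\<rho> ((m + l) * y / (l * y + k))
      = log ?\<rho> ((m + l) * y) - log ?\<rho> (l * y + k)"
    using eventually_gt_at_top[of 0]
  proof eventually_elim
    case (elim y)
    then show ?case using assms by (intro log_divide_pos) auto
  qed
  moreover have "log ?\<rho> ?\<rho> = 1"
    using rho by (intro log_eq_one) linarith+
  ultimately show ?thesis
    by (simp only: tendsto_cong)
qed

theorem proposition5p1:
  fixes m l :: int
  assumes "m \<in> pos_ints" and "l \<in> pos_ints"
  shows "\<exists>c :: int \<Rightarrow> nat. coloring 3 pos_ints c \<and>
    (\<forall>B t. B \<subseteq> pos_ints \<and> infinite B \<and> pattern m l t B \<subseteq> pos_ints
      \<longrightarrow> \<not> monochromatic c (pattern m l t B))"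
proof -
  define \<rho> where "\<rho> = (real_of_int m + real_of_int l) / real_of_int l"
  have ml: "real_of_int m > 0" "real_of_int l > 0"
    using assms by (auto simp: pos_ints_def)
  have "coloring 3 pos_ints (log_coloring \<rho>)"
    by (simp add: coloring_def log_coloring_def nat_less_iff)
  moreover have "\<not> monochromatic (log_coloring \<rho>) (pattern m l t B)"
    if B: "B \<subseteq> pos_ints" "infinite B" for B t
  proof -
    obtain x where x: "x \<in> B"
      using B(2) by (metis ex_in_conv finite.emptyI)
    let ?d = "\<lambda>y. log \<rho> ((real_of_int m + real_of_int l) * y)
      - log \<rho> (real_of_int l * y + real_of_int (m * x + t))"
    have lim: "(?d \<longlongrightarrow> 1) at_top"
      unfolding \<rho>_def by (rule log_ratio_tendsto_1[OF ml])
    have "\<forall>\<^sub>F y in at_top. 2/3 < ?d y \<and> ?d y < 4/3"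
      using order_tendstoD(1)[OF lim, of "2/3"] order_tendstoD(2)[OF lim, of "4/3"]
      by (simp add: eventually_conj)
    then obtain N where N: "\<And>y. y \<ge> N \<Longrightarrow> 2/3 < ?d y \<and> ?d y < 4/3"
      unfolding eventually_at_top_linorder by blast
    obtain y where y: "y \<in> B" "y > max x \<lceil>N\<rceil>"
    proof -
      have "\<not> B \<subseteq> {1..max x \<lceil>N\<rceil>}"
        using B(2) finite_subset by blast
      then show thesis
        using B(1) that by (force simp: pos_ints_def)
    qed
    from y(2) have "real_of_int y \<ge> N" by linarith
    from N[OF this] have "log_coloring \<rho> ((m + l) * y) \<noteq> log_coloring \<rho> (m * x + l * y + t)"
      by (intro log_coloring_neq) (simp_all add: algebra_simps)
    moreover have "(m + l) * y \<in> pattern m l t B" "m * x + l * y + t \<in> pattern m l t B"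
      using x y by (auto simp: pattern_def)
    ultimately show ?thesis
      unfolding monochromatic_def by blast
  qed
  ultimately show ?thesis by blast
qed

end
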